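(* Let $m\ge 1$, let $\mathcal{X}$ be a Banach space, let $f:\mathbb{R}^m\to\mathcal{X}$ be a continuous function and let $\mathcal{G}$ be a dense subset of $\mathbb{R}^m$. Then $f$ is compact almost automorphic if and only if it is $\mathcal{G}$-almost automorphic and uniformly continuous. Thus $$\mathcal{K}AA(\mathbb{R}^m;\mathcal{X})=\mathcal{G}AA(\mathbb{R}^m;\mathcal{X})\cap UC(\mathbb{R}^m;\mathcal{X}).$$
   Context: For a non-empty set $\mathcal{G}\subset\mathbb{R}^m$, a continuous function $f:\mathbb{R}^m\to\mathcal{X}$ is called $\mathcal{G}$-(multi-)almost automorphic if for every sequence $(\mathbf{b}_k)$ of elements of $\mathcal{G}$ there exist a subsequence $(\mathbf{b}_{k_l})$ and a function $f^*:\mathbb{R}^m\to\mathcal{X}$ such that, for every $\mathbf{t}\in\mathbb{R}^m$, $\lim_{l\to\infty}f(\mathbf{t}+\mathbf{b}_{k_l})=f^*(\mathbf{t})$ and $\lim_{l\to\infty}f^*(\mathbf{t}-\mathbf{b}_{k_l})=f(\mathbf{t})$. The space of these functions is $\mathcal{G}AA(\mathbb{R}^m;\mathcal{X})$. A continuous function $f:\mathbb{R}^m\to\mathcal{X}$ is compact almost automorphic if for every sequence $(\mathbf{b}_k)$ in $\mathbb{R}^m$ there exist a subsequence $(\mathbf{b}_{k_l})$ and a function $f^*:\mathbb{R}^m\to\mathcal{X}$ such that for every compact $\mathcal{K}\subset\mathbb{R}^m$, $\lim_{l}\sup_{\mathbf{t}\in\mathcal{K}}\|f(\mathbf{t}+\mathbf{b}_{k_l})-f^*(\mathbf{t})\|=0$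 and $\lim_l\sup_{\mathbf{t}\in\mathcal{K}}\|f^*(\mathbf{t}-\mathbf{b}_{k_l})-f(\mathbf{t})\|=0$. The space of these functions is $\mathcal{K}AA(\mathbb{R}^m;\mathcal{X})$. $UC(\mathbb{R}^m;\mathcal{X})$ is the space of uniformly continuous functions $\mathbb{R}^m\to\mathcal{X}$. *)

theory Defs
  imports "HOL-Analysis.Analysis"
begin

definition almost_automorphic_wrt ::
    "(real ^ 'm) set \<Rightarrow> (real ^ 'm \<Rightarrow> 'x::banach) \<Rightarrow> bool" where
  "almost_automorphic_wrt G f \<longleftrightarrow>
     continuous_on UNIV f \<and>
     (\<forall>b :: nat \<Rightarrow> real ^ 'm. range b \<subseteq> G \<longrightarrow>
        (\<exists>(r :: nat \<Rightarrow> nat) (f' :: real ^ 'm \<Rightarrow> 'x). strict_mono r \<and>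
           (\<forall>t. (\<lambda>l. f (t + b (r l))) \<longlonglongrightarrow> f' t \<and>
                (\<lambda>l. f' (t - b (r l))) \<longlonglongrightarrow> f t)))"

text \<open>The suprema are taken in \<^typ>\<open>ennreal\<close>: the limit function is not required to be
  bounded on compact sets, and a real-valued supremum of an unbounded set would be an
  unspecified value instead of infinity. For empty \<open>K\<close> the supremum is 0.\<close>

definition compact_almost_automorphic :: "(real ^ 'm \<Rightarrow> 'x::banach) \<Rightarrow> bool" where
  "compact_almost_automorphic f \<longleftrightarrow>
     continuous_on UNIV f \<and>
     (\<forall>b :: nat \<Rightarrow> real ^ 'm.
        \<exists>(r :: nat \<Rightarrow> nat) (f' :: real ^ 'm \<Rightarrow> 'x). strict_mono r \<and>
          (\<forall>K. compact K \<longrightarrow>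
             (\<lambda>l. SUP t\<in>K. ennreal (norm (f (t + b (r l)) - f' t))) \<longlonglongrightarrow> 0 \<and>
             (\<lambda>l. SUP t\<in>K. ennreal (norm (f' (t - b (r l)) - f t))) \<longlonglongrightarrow> 0))"

definition AA_space :: "(real ^ 'm) set \<Rightarrow> (real ^ 'm \<Rightarrow> 'x::banach) set" where
  "AA_space G = {f. almost_automorphic_wrt G f}"

definition KAA_space :: "(real ^ 'm \<Rightarrow> 'x::banach) set" where
  "KAA_space = {f. compact_almost_automorphic f}"

definition UC_space :: "(real ^ 'm \<Rightarrow> 'x::banach) set" where
  "UC_space = {f. uniformly_continuous_on UNIV f}"

end

theory Submission
  imports Defs
begin

text \<open>
  The suprema in the definition of compact almost automorphy tend to 0 exactly when the
  convergence is uniform on the given compact set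
  (\<open>tendsto_SUP_ennreal_norm_iff_uniform_limit\<close>), so the theorem compares pointwise limits of
  translates with limits that are uniform on compact sets.

  A compact almost automorphic function is trivially almost automorphic along any set of
  translations, because points are compact. It is uniformly continuous because otherwise there
  are sequences \<open>x\<^sub>n\<close>, \<open>y\<^sub>n\<close> with \<open>x\<^sub>n - y\<^sub>n\<close> tending to 0 whose images stay apart; a subsequence of
  the translates by \<open>x\<^sub>n\<close> converges uniformly on the unit ball to a function that is therefore
  continuous at 0, and its value at 0 is then the common limit of both image sequences.

  Conversely, uniform continuity is used twice. It allows a translation sequence to be replaced
  by one in the dense set at vanishing distance, without changing any pointwise limit. It also
  makes the translates uniformly equicontinuous, with a modulus that passes to the limit
  function and hence to the translates of the limit function; for equicontinuous sequences
  pointwise convergence is uniform on compact sets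
  (\<open>uniform_limit_compact_if_uniformly_equicontinuous\<close>).
\<close>

lemma tendsto_SUP_ennreal_norm_iff_uniform_limit:
  fixes f :: "'i \<Rightarrow> 'a \<Rightarrow> 'b::real_normed_vector"
  shows "((\<lambda>i. SUP t\<in>K. ennreal (norm (f i t - g t))) \<longlongrightarrow> 0) F \<longleftrightarrow> uniform_limit K f g F"
proof
  assume lim: "((\<lambda>i. SUP t\<in>K. ennreal (norm (f i t - g t))) \<longlongrightarrow> 0) F"
  show "uniform_limit K f g F"
  proof (rule uniform_limitI)
    fix e :: real
    assume "e > 0"
    then have "\<forall>\<^sub>F i in F. (SUP t\<in>K. ennreal (norm (f i t - g t))) < ennreal e"
      by (intro order_tendstoD(2)[OF lim]) simp
    then show "\<forall>\<^sub>F i in F. \<forall>t\<in>K. dist (f i t) (g t) < e"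
    proof eventually_elim
      case (elim i)
      show ?case
      proof
        fix t
        assume "t \<in> K"
        then have "ennreal (norm (f i t - g t)) < ennreal e"
          using elim by (meson SUP_upper le_less_trans)
        then show "dist (f i t) (g t) < e"
          by (simp add: dist_norm ennreal_less_iff)
      qed
    qed
  qed
next
  assume lim: "uniform_limit K f g F"
  show "((\<lambda>i. SUP t\<in>K. ennreal (norm (f i t - g t))) \<longlongrightarrow> 0) F"
  proof (rule order_tendstoI)
    fix a :: ennreal
    assume "0 < a"
    then obtain c where c: "0 < c" "c < a"
      using dense by blast
    then obtain e where e: "c = ennreal e" "e > 0"
      by (cases c) (auto simp: top_unique)
    have "\<forall>\<^sub>F i in F. \<forall>t\<in>K. dist (f i t) (g t) < e"
      using lim e(2) by (rule uniform_limitD)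
    then show "\<forall>\<^sub>F i in F. (SUP t\<in>K. ennreal (norm (f i t - g t))) < a"
    proof eventually_elim
      case (elim i)
      have "(SUP t\<in>K. ennreal (norm (f i t - g t))) \<le> ennreal e"
        using elim by (intro SUP_least ennreal_leI) (auto simp: dist_norm less_imp_le)
      then show ?case
        using c e by auto
    qed
  qed simp
qed

text \<open>The estimate \<open>dist (F n x) (F n y) \<le> e/2\<close>, valid for all \<open>n\<close> and all close \<open>x\<close>, \<open>y\<close>, is
  closed under pointwise limits.\<close>

lemma uniformly_continuous_limit_if_uniformly_equicontinuous:
  fixes F :: "nat \<Rightarrow> 'a::metric_space \<Rightarrow> 'b::metric_space"
  assumes equi: "\<And>e. e > 0 \<Longrightarrow> \<exists>d>0. \<forall>n x y. dist x y < d \<longrightarrow> dist (F n x) (F n y) < e"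
    and lim: "\<And>x. (\<lambda>n. F n x) \<longlonglongrightarrow> L x"
  shows "uniformly_continuous_on UNIV L"
  unfolding uniformly_continuous_on_def
proof (intro allI impI)
  fix e :: real
  assume "e > 0"
  then obtain d where d: "d > 0" "\<And>n x y. dist x y < d \<Longrightarrow> dist (F n x) (F n y) < e / 2"
    using equi[of "e / 2"] by auto
  have "dist (L y) (L x) < e" if "dist y x < d" for x y
  proof -
    have "dist (L y) (L x) \<le> e / 2"
      using d(2)[OF that]
      by (intro LIMSEQ_le_const2[OF tendsto_dist[OF lim lim]]) (auto intro: less_imp_le)
    then show ?thesis
      using \<open>e > 0\<close> by simp
  qed
  then show "\<exists>d>0. \<forall>x\<in>UNIV. \<forall>y\<in>UNIV. dist y x < d \<longrightarrow> dist (L y) (L x) < e"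
    using d(1) by blast
qed

text \<open>Finitely many balls of the radius given by equicontinuity cover the compact set, and
  pointwise convergence at their finitely many centres controls the whole set.\<close>

lemma uniform_limit_compact_if_uniformly_equicontinuous:
  fixes F :: "nat \<Rightarrow> 'a::metric_space \<Rightarrow> 'b::metric_space"
  assumes equi: "\<And>e. e > 0 \<Longrightarrow> \<exists>d>0. \<forall>n x y. dist x y < d \<longrightarrow> dist (F n x) (F n y) < e"
    and lim: "\<And>x. (\<lambda>n. F n x) \<longlonglongrightarrow> L x"
    and K: "compact K"
  shows "uniform_limit K F L sequentially"
proof (rule uniform_limitI)
  fix e :: real
  assume "e > 0"
  then have e: "e / 3 > 0"
    by simp
  obtain d1 where d1: "d1 > 0" "\<And>n x y. dist x y < d1 \<Longrightarrow> dist (F n x) (F n y) < e / 3"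
    using equi[OF e] by auto
  have "uniformly_continuous_on UNIV L"
    using equi lim by (rule uniformly_continuous_limit_if_uniformly_equicontinuous)
  then obtain d2 where d2: "d2 > 0" "\<And>x y. dist x y < d2 \<Longrightarrow> dist (L x) (L y) < e / 3"
    using e unfolding uniformly_continuous_on_def by (metis UNIV_I)
  define d where "d = min d1 d2"
  have "d > 0"
    using d1(1) d2(1) by (simp add: d_def)
  then obtain C where C: "finite C" "K \<subseteq> (\<Union>c\<in>C. ball c d)"
    using K unfolding compact_eq_totally_bounded by blast
  have "\<forall>\<^sub>F n in sequentially. \<forall>c\<in>C. dist (F n c) (L c) < e / 3"
    using C(1) by (intro eventually_ball_finite ballI tendstoD[OF lim e])
  then show "\<forall>\<^sub>F n in sequentially. \<forall>x\<in>K. dist (F n x) (L x) < e"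
  proof eventually_elim
    case (elim n)
    show ?case
    proof
      fix x
      assume "x \<in> K"
      then obtain c where c: "c \<in> C" "dist c x < d"
        using C(2) by auto
      then have "dist (F n c) (F n x) < e / 3" "dist (L c) (L x) < e / 3"
        using d1(2) d2(2) by (auto simp: d_def)
      moreover have "dist (F n c) (L c) < e / 3"
        using elim c(1) by blast
      ultimately show "dist (F n x) (L x) < e"
        using dist_triangle[of "F n x" "L x" "F n c"] dist_triangle[of "F n c" "L x" "L c"]
        by (simp add: dist_commute)
    qed
  qed
qed

lemma uniformly_equicontinuous_translates:
  fixes f :: "'a::real_normed_vector \<Rightarrow> 'b::metric_space"
  assumes "uniformly_continuous_on UNIV f" and "e > 0"
  shows "\<exists>d>0. \<forall>(n::'i) x y. dist x y < d \<longrightarrow> dist (f (x + b n)) (f (y + b n)) < e"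
proof -
  obtain d where "d > 0" "\<And>x y. dist x y < d \<Longrightarrow> dist (f x) (f y) < e"
    using assms unfolding uniformly_continuous_on_def by (metis UNIV_I)
  then show ?thesis
    by (intro exI[of _ d]) simp
qed

lemma uniformly_continuous_tendsto_perturb:
  fixes f :: "'a::real_normed_vector \<Rightarrow> 'b::real_normed_vector"
  assumes "uniformly_continuous_on UNIV f"
    and "(\<lambda>n. f (x n)) \<longlonglongrightarrow> l" and "(\<lambda>n. y n - x n) \<longlonglongrightarrow> 0"
  shows "(\<lambda>n. f (y n)) \<longlonglongrightarrow> l"
proof -
  have "(\<lambda>n. dist (y n) (x n)) \<longlonglongrightarrow> 0"
    using tendsto_norm_zero[OF assms(3)] by (simp add: dist_norm)
  then have "(\<lambda>n. dist (f (y n)) (f (x n))) \<longlonglongrightarrow> 0"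
    using assms(1) unfolding uniformly_continuous_on_sequentially by auto
  then have "(\<lambda>n. f (y n) - f (x n)) \<longlonglongrightarrow> 0"
    by (simp add: dist_norm tendsto_norm_zero_iff)
  from tendsto_add[OF this assms(2)] show ?thesis
    by simp
qed

lemma compact_almost_automorphic_iff_uniform_limit:
  fixes f :: "real ^ 'm \<Rightarrow> 'x::banach"
  shows "compact_almost_automorphic f \<longleftrightarrow>
    continuous_on UNIV f \<and>
    (\<forall>b. \<exists>(r::nat \<Rightarrow> nat) f'. strict_mono r \<and>
      (\<forall>K. compact K \<longrightarrow>
        uniform_limit K (\<lambda>l t. f (t + b (r l))) f' sequentially \<and>
        uniform_limit K (\<lambda>l t. f' (t - b (r l))) f sequentially))"
  unfolding compact_almost_automorphic_def tendsto_SUP_ennreal_norm_iff_uniform_limit ..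

lemma almost_automorphic_wrt_if_compact_almost_automorphic:
  fixes f :: "real ^ 'm \<Rightarrow> 'x::banach"
  assumes "compact_almost_automorphic f"
  shows "almost_automorphic_wrt G f"
  unfolding almost_automorphic_wrt_def
proof (intro conjI allI impI)
  show "continuous_on UNIV f"
    using assms by (simp add: compact_almost_automorphic_def)
  fix b :: "nat \<Rightarrow> real ^ 'm"
  obtain r :: "nat \<Rightarrow> nat" and f' where r: "strict_mono r"
    and lim: "\<And>K. compact K \<Longrightarrow> uniform_limit K (\<lambda>l t. f (t + b (r l))) f' sequentially"
      "\<And>K. compact K \<Longrightarrow> uniform_limit K (\<lambda>l t. f' (t - b (r l))) f sequentially"
    using assms unfolding compact_almost_automorphic_iff_uniform_limit by meson
  have "(\<lambda>l. f (t + b (r l))) \<longlonglongrightarrow> f' t \<and> (\<lambda>l. f' (t - b (r l))) \<longlonglongrightarrow> f t" for t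
    using tendsto_uniform_limitI[OF lim(1), of "{t}" t] tendsto_uniform_limitI[OF lim(2), of "{t}" t]
    by simp
  then show "\<exists>(r::nat \<Rightarrow> nat) f'. strict_mono r \<and>
      (\<forall>t. (\<lambda>l. f (t + b (r l))) \<longlonglongrightarrow> f' t \<and> (\<lambda>l. f' (t - b (r l))) \<longlonglongrightarrow> f t)"
    using r by blast
qed

text \<open>Translating by one of two merging sequences moves it to the origin and turns the other into
  a null sequence, where uniform convergence near the origin to a continuous limit applies.\<close>

lemma uniformly_continuous_if_compact_almost_automorphic:
  fixes f :: "real ^ 'm \<Rightarrow> 'x::banach"
  assumes "compact_almost_automorphic f"
  shows "uniformly_continuous_on UNIV f"
proof (rule ccontr)
  assume "\<not> uniformly_continuous_on UNIV f"
  then obtain e where e: "e > 0"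
    and "\<forall>d>0. \<exists>x y. dist y x < d \<and> \<not> dist (f y) (f x) < e"
    unfolding uniformly_continuous_on_def by auto
  then have "\<forall>n. \<exists>x y. dist y x < inverse (real (Suc n)) \<and> \<not> dist (f y) (f x) < e"
    by simp
  then obtain x y where xy: "\<And>n. dist (y n) (x n) < inverse (real (Suc n))"
    and far: "\<And>n. \<not> dist (f (y n)) (f (x n)) < e"
    by metis
  obtain r :: "nat \<Rightarrow> nat" and f' where r: "strict_mono r"
    and lim: "\<And>K. compact K \<Longrightarrow> uniform_limit K (\<lambda>l t. f (t + x (r l))) f' sequentially"
    using assms unfolding compact_almost_automorphic_iff_uniform_limit by meson
  define B :: "(real ^ 'm) set" where "B = cball 0 1"
  have limB: "uniform_limit B (\<lambda>l t. f (t + x (r l))) f' sequentially"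
    unfolding B_def by (intro lim compact_cball)
  have "continuous_on UNIV f"
    using assms by (simp add: compact_almost_automorphic_def)
  then have "continuous_on B (\<lambda>t. f (t + x (r l)))" for l
    by (rule continuous_on_compose2) (auto intro: continuous_on_add)
  then have "continuous_on B f'"
    by (intro uniform_limit_theorem[OF _ limB]) auto
  have z_B: "y n - x n \<in> B" for n
  proof -
    have "dist (y n) (x n) < 1"
      using xy[of n] by (rule less_le_trans) (simp add: divide_simps)
    then show ?thesis
      by (simp add: B_def dist_norm norm_minus_commute)
  qed
  have "(\<lambda>n. y n - x n) \<longlonglongrightarrow> 0"
    using xy
    by (intro LIMSEQ_norm_0) (simp add: dist_norm inverse_eq_divide)
  then have z_lim: "(\<lambda>l. y (r l) - x (r l)) \<longlonglongrightarrow> 0"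
    by (rule LIMSEQ_subseq_LIMSEQ[OF _ r, unfolded o_def])
  have f'_z: "(\<lambda>l. f' (y (r l) - x (r l))) \<longlonglongrightarrow> f' 0"
    using \<open>continuous_on B f'\<close> z_lim z_B
    by (intro continuous_on_tendsto_compose[of B f' "\<lambda>l. y (r l) - x (r l)" 0])
       (auto simp: B_def)
  have "\<forall>\<^sub>F l in sequentially. \<forall>t\<in>B. dist (f (t + x (r l))) (f' t) < e / 3"
    using e by (intro uniform_limitD[OF limB]) simp
  moreover have "\<forall>\<^sub>F l in sequentially. dist (f' (y (r l) - x (r l))) (f' 0) < e / 3"
    using e by (intro tendstoD[OF f'_z]) simp
  ultimately have "\<forall>\<^sub>F l in sequentially. False"
  proof eventually_elim
    case (elim l)
    have "dist (f (y (r l))) (f' (y (r l) - x (r l))) < e / 3"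
      using elim(1) z_B[of "r l"] by fastforce
    moreover have "0 \<in> B"
      by (simp add: B_def)
    then have "dist (f (x (r l))) (f' 0) < e / 3"
      using elim(1) by fastforce
    ultimately have "dist (f (y (r l))) (f (x (r l))) < e"
      using elim(2) dist_triangle[of "f (y (r l))" "f (x (r l))" "f' (y (r l) - x (r l))"]
        dist_triangle[of "f' (y (r l) - x (r l))" "f (x (r l))" "f' 0"]
      by (simp add: dist_commute)
    then show ?case
      using far by blast
  qed
  then show False
    by simp
qed

text \<open>The given translations \<open>b\<close> are approximated by \<open>g\<close> in \<open>G\<close> with \<open>g - b\<close> tending to 0. Going
  back from \<open>g\<close> to \<open>b\<close> in the second limit needs uniform continuity of the limit function \<open>f'\<close>,
  which is why this is derived before the limits along \<open>b\<close>.\<close>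

lemma compact_almost_automorphic_if_uniformly_continuous:
  fixes f :: "real ^ 'm \<Rightarrow> 'x::banach"
  assumes dense: "closure G = UNIV"
    and aa: "almost_automorphic_wrt G f"
    and uc: "uniformly_continuous_on UNIV f"
  shows "compact_almost_automorphic f"
  unfolding compact_almost_automorphic_iff_uniform_limit
proof (intro conjI allI)
  show "continuous_on UNIV f"
    using aa by (simp add: almost_automorphic_wrt_def)
  fix b :: "nat \<Rightarrow> real ^ 'm"
  have "\<exists>g\<in>G. dist g (b n) < inverse (real (Suc n))" for n
    using dense closure_approachable[of "b n" G] by simp
  then obtain g where g: "\<And>n. g n \<in> G" "\<And>n. dist (g n) (b n) < inverse (real (Suc n))"
    by metis
  then have "range g \<subseteq> G"
    by auto
  then obtain r :: "nat \<Rightarrow> nat" and f' where r: "strict_mono r"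
    and lim_g: "\<And>t. (\<lambda>l. f (t + g (r l))) \<longlonglongrightarrow> f' t" "\<And>t. (\<lambda>l. f' (t - g (r l))) \<longlonglongrightarrow> f t"
    using aa unfolding almost_automorphic_wrt_def by metis
  have "(\<lambda>n. g n - b n) \<longlonglongrightarrow> 0"
    using g(2) by (intro LIMSEQ_norm_0) (simp add: dist_norm inverse_eq_divide)
  then have gb: "(\<lambda>l. g (r l) - b (r l)) \<longlonglongrightarrow> 0"
    by (rule LIMSEQ_subseq_LIMSEQ[OF _ r, unfolded o_def])
  then have bg: "(\<lambda>l. b (r l) - g (r l)) \<longlonglongrightarrow> 0"
    using tendsto_minus[OF gb] by simp
  have uc': "uniformly_continuous_on UNIV f'"
    using uniformly_equicontinuous_translates[OF uc] lim_g(1)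
    by (rule uniformly_continuous_limit_if_uniformly_equicontinuous)
  have lim: "(\<lambda>l. f (t + b (r l))) \<longlonglongrightarrow> f' t" for t
    using bg by (intro uniformly_continuous_tendsto_perturb[OF uc lim_g(1)]) simp
  have lim': "(\<lambda>l. f' (t + - b (r l))) \<longlonglongrightarrow> f t" for t
    using gb by (intro uniformly_continuous_tendsto_perturb[OF uc' lim_g(2)]) simp
  have "uniform_limit K (\<lambda>l t. f (t + b (r l))) f' sequentially" if "compact K" for K
    using uniformly_equicontinuous_translates[OF uc] lim that
    by (rule uniform_limit_compact_if_uniformly_equicontinuous)
  moreover have "uniform_limit K (\<lambda>l t. f' (t + - b (r l))) f sequentially" if "compact K" for K
    using uniformly_equicontinuous_translates[OF uc'] lim' that
    by (rule uniform_limit_compact_if_uniformly_equicontinuous)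
  ultimately show "\<exists>(r::nat \<Rightarrow> nat) f'. strict_mono r \<and>
      (\<forall>K. compact K \<longrightarrow>
        uniform_limit K (\<lambda>l t. f (t + b (r l))) f' sequentially \<and>
        uniform_limit K (\<lambda>l t. f' (t - b (r l))) f sequentially)"
    using r by (intro exI[of _ r] exI[of _ f']) simp
qed

theorem theorem4p3:
  fixes f :: "real ^ 'm \<Rightarrow> 'x::banach"
    and G :: "(real ^ 'm) set"
  assumes "continuous_on UNIV f"
    and "closure G = UNIV"
  shows "(compact_almost_automorphic f \<longleftrightarrow>
            almost_automorphic_wrt G f \<and> uniformly_continuous_on UNIV f) \<and>
         (KAA_space :: (real ^ 'm \<Rightarrow> 'x) set) = AA_space G \<inter> UC_space"
proof -
  have iff: "compact_almost_automorphic h \<longleftrightarrow>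
      almost_automorphic_wrt G h \<and> uniformly_continuous_on UNIV h" for h :: "real ^ 'm \<Rightarrow> 'x"
    using almost_automorphic_wrt_if_compact_almost_automorphic
      uniformly_continuous_if_compact_almost_automorphic
      compact_almost_automorphic_if_uniformly_continuous[OF assms(2)]
    by blast
  then show ?thesis
    by (auto simp: KAA_space_def AA_space_def UC_space_def)
qed

end
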